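(* Let $H_A$ and $H_B$ be two contextuality scenarios and $p\in\mathcal{G}(H_A\otimes H_B)$. Then $p$ is a quantum model on $H_A\otimes H_B$ if and only if there are a Hilbert space $\mathcal{H}$, a quantum state $\rho$ on $\mathcal{H}$, and projection operators $P_{A,u}$ and $P_{B,v}$ on $\mathcal{H}$ assigned to every $u\in V(H_A)$ and $v\in V(H_B)$ such that $$\sum_{u\in e_A}P_{A,u}=\mathbbm{1}_{\mathcal{H}}=\sum_{v\in e_B}P_{B,v}\qquad\forall e_A\in E(H_A),\ e_B\in E(H_B),$$ $$[P_{A,u},P_{B,v}]=0\qquad\forall u\in V(H_A),\ v\in V(H_B),$$ and $$p(u,v)=\mathrm{tr}(\rho\,P_{A,u}P_{B,v})\qquad\forall u\in V(H_A),\ v\in V(H_B).$$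
   Context: A contextuality scenario is a hypergraph $H$ with finite nonempty vertex set $V(H)$ and edge set $E(H)\subseteq 2^{V(H)}$ such that $\bigcup_{e\in E(H)}e=V(H)$. A probabilistic model on $H$ is a map $p:V(H)\to[0,1]$ with $\sum_{v\in e}p(v)=1$ for all $e\in E(H)$; $\mathcal{G}(H)$ is the set of these. The Foulis–Randall product $H_A\otimes H_B$ has vertex set $V(H_A)\times V(H_B)$ and as edges all sets $\bigcup_{a\in e_A}\{a\}\times f(a)$ with $e_A\in E(H_A)$, $f:e_A\to E(H_B)$, and all sets $\bigcup_{b\in e_B}f(b)\times\{b\}$ with $e_B\in E(H_B)$, $f:e_B\to E(H_A)$. Hilbert spaces are complex and possibly infinite-dimensional; a quantum state on $\mathcal{H}$ is a positive semidefinite trace-class operator $\rho$ with $\mathrm{tr}\,\rho=1$; projections are orthogonal projections. A map $p:V(H)\to[0,1]$ is a quantum model on $H$ if there exist a Hilbert space $\mathcal{H}$, a quantum state $\rho$ on $\mathcal{H}$ and projections $P_v$ ($v\in V(H)$) with $\sum_{v\in e}P_v=\mathbbm{1}_{\mathcal{H}}$ for all $e\in E(H)$ and $p(v)=\mathrm{tr}(\rho P_v)$ for all $v\in V(H)$. *)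

theory Defs
  imports "HOL-Analysis.Analysis" "HOL-Algebra.Module"
begin

section \<open>Contextuality scenarios\<close>

record 'v hypergraph =
  verts :: "'v set"
  edges :: "'v set set"

locale contextuality_scenario =
  fixes H :: "'v hypergraph"
  assumes finite_verts: "finite (verts H)"
    and verts_nonempty: "verts H \<noteq> {}"
    and edges_subset: "edges H \<subseteq> Pow (verts H)"
    and edges_cover: "\<Union> (edges H) = verts H"

text \<open>The values of a model outside the vertex set are irrelevant.\<close>

definition prob_models :: "'v hypergraph \<Rightarrow> ('v \<Rightarrow> real) set" where
  "prob_models H = {p \<in> verts H \<rightarrow> {0..1}. \<forall>e\<in>edges H. (\<Sum>v\<in>e. p v) = 1}"

definition foulis_randall ::
  "'a hypergraph \<Rightarrow> 'b hypergraph \<Rightarrow> ('a \<times> 'b) hypergraph" (infixr \<open>\<otimes>\<^sub>F\<^sub>R\<close> 70) where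
  "HA \<otimes>\<^sub>F\<^sub>R HB =
    \<lparr>verts = verts HA \<times> verts HB,
     edges = {(\<Union>a\<in>eA. {a} \<times> f a) | eA f. eA \<in> edges HA \<and> f \<in> eA \<rightarrow> edges HB}
           \<union> {(\<Union>b\<in>eB. f b \<times> {b}) | eB f. eB \<in> edges HB \<and> f \<in> eB \<rightarrow> edges HA}\<rparr>"


section \<open>Complex Hilbert spaces\<close>

text \<open>
  Hilbert spaces are carrier-based, so that one can quantify existentially over them inside a
  formula.  The type of vectors \<open>'h\<close> plays the role of a universe: the Hilbert spaces
  considered are all those whose underlying set is a subset of \<open>'h\<close>.
\<close>

definition complex_ring :: "complex ring" where
  "complex_ring = \<lparr>carrier = UNIV, monoid.mult = (*), one = 1, ring.zero = 0, add = (+)\<rparr>"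

text \<open>The multiplicative fields inherited from \<open>ring\<close> carry no meaning here,
  as for every \<open>module\<close>.\<close>

record 'h hilbert = "(complex, 'h) module" +
  cinner :: "'h \<Rightarrow> 'h \<Rightarrow> complex"

definition hnorm :: "'h hilbert \<Rightarrow> 'h \<Rightarrow> real" where
  "hnorm \<H> x = sqrt (Re (cinner \<H> x x))"

locale hilbert_space = module complex_ring \<H> for \<H> :: "'h hilbert" (structure) +
  assumes cinner_add_right: "\<lbrakk>x \<in> carrier \<H>; y \<in> carrier \<H>; z \<in> carrier \<H>\<rbrakk> \<Longrightarrow>
        cinner \<H> x (y \<oplus>\<^bsub>\<H>\<^esub> z) = cinner \<H> x y + cinner \<H> x z"
    and cinner_smult_right: "\<lbrakk>x \<in> carrier \<H>; y \<in> carrier \<H>\<rbrakk> \<Longrightarrow>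
        cinner \<H> x (c \<odot>\<^bsub>\<H>\<^esub> y) = c * cinner \<H> x y"
    and cinner_commute: "\<lbrakk>x \<in> carrier \<H>; y \<in> carrier \<H>\<rbrakk> \<Longrightarrow>
        cinner \<H> y x = cnj (cinner \<H> x y)"
    and cinner_nonneg: "x \<in> carrier \<H> \<Longrightarrow> cinner \<H> x x \<in> \<real>\<^sub>\<ge>\<^sub>0"
    and cinner_definite: "\<lbrakk>x \<in> carrier \<H>; cinner \<H> x x = 0\<rbrakk> \<Longrightarrow> x = \<zero>\<^bsub>\<H>\<^esub>"
    and complete: "\<lbrakk>\<And>n. X n \<in> carrier \<H>;
          \<forall>\<epsilon>>0. \<exists>N. \<forall>m\<ge>N. \<forall>n\<ge>N. hnorm \<H> (X m \<ominus>\<^bsub>\<H>\<^esub> X n) < \<epsilon>\<rbrakk> \<Longrightarrow>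
        \<exists>x\<in>carrier \<H>. (\<lambda>n. hnorm \<H> (X n \<ominus>\<^bsub>\<H>\<^esub> x)) \<longlonglongrightarrow> 0"


section \<open>Operators and states\<close>

text \<open>Operators are functions on the type of vectors of which only the values on the carrier
  matter; equality of operators is pointwise equality on the carrier.\<close>

definition bounded_operator :: "'h hilbert \<Rightarrow> ('h \<Rightarrow> 'h) \<Rightarrow> bool" where
  "bounded_operator \<H> T \<longleftrightarrow>
    T \<in> carrier \<H> \<rightarrow> carrier \<H> \<and>
    (\<forall>x\<in>carrier \<H>. \<forall>y\<in>carrier \<H>. T (x \<oplus>\<^bsub>\<H>\<^esub> y) = T x \<oplus>\<^bsub>\<H>\<^esub> T y) \<and>
    (\<forall>c. \<forall>x\<in>carrier \<H>. T (c \<odot>\<^bsub>\<H>\<^esub> x) = c \<odot>\<^bsub>\<H>\<^esub> T x) \<and>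
    (\<exists>K. \<forall>x\<in>carrier \<H>. hnorm \<H> (T x) \<le> K * hnorm \<H> x)"

definition is_adjoint :: "'h hilbert \<Rightarrow> ('h \<Rightarrow> 'h) \<Rightarrow> ('h \<Rightarrow> 'h) \<Rightarrow> bool" where
  "is_adjoint \<H> T S \<longleftrightarrow>
    (\<forall>x\<in>carrier \<H>. \<forall>y\<in>carrier \<H>. cinner \<H> (T x) y = cinner \<H> x (S y))"

definition projection :: "'h hilbert \<Rightarrow> ('h \<Rightarrow> 'h) \<Rightarrow> bool" where
  "projection \<H> P \<longleftrightarrow>
    bounded_operator \<H> P \<and> (\<forall>x\<in>carrier \<H>. P (P x) = P x) \<and> is_adjoint \<H> P P"

definition positive_operator :: "'h hilbert \<Rightarrow> ('h \<Rightarrow> 'h) \<Rightarrow> bool" where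
  "positive_operator \<H> T \<longleftrightarrow>
    bounded_operator \<H> T \<and> (\<forall>x\<in>carrier \<H>. cinner \<H> x (T x) \<in> \<real>\<^sub>\<ge>\<^sub>0)"

text \<open>Completeness of the orthonormal system is expressed by maximality, which in a Hilbert space
  amounts to density of the linear span.\<close>

definition orthonormal_basis :: "'h hilbert \<Rightarrow> 'h set \<Rightarrow> bool" where
  "orthonormal_basis \<H> B \<longleftrightarrow>
    B \<subseteq> carrier \<H> \<and>
    (\<forall>x\<in>B. \<forall>y\<in>B. cinner \<H> x y = (if x = y then 1 else 0)) \<and>
    (\<forall>x\<in>carrier \<H>. (\<forall>b\<in>B. cinner \<H> b x = 0) \<longrightarrow> x = \<zero>\<^bsub>\<H>\<^esub>)"

text \<open>\<open>S\<close> is the adjoint of \<open>T\<close>, and \<open>R\<close> is the absolute value of \<open>T\<close>,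
  i.e. the positive square root of \<open>S \<circ> T\<close>.\<close>

definition trace_class :: "'h hilbert \<Rightarrow> ('h \<Rightarrow> 'h) \<Rightarrow> bool" where
  "trace_class \<H> T \<longleftrightarrow>
    bounded_operator \<H> T \<and>
    (\<exists>S R B. bounded_operator \<H> S \<and> is_adjoint \<H> T S \<and>
       positive_operator \<H> R \<and> (\<forall>x\<in>carrier \<H>. R (R x) = S (T x)) \<and>
       orthonormal_basis \<H> B \<and> (\<lambda>b. cinner \<H> b (R b)) summable_on B)"

text \<open>For trace-class operators the sum does not depend on the orthonormal basis.\<close>

definition op_trace :: "'h hilbert \<Rightarrow> ('h \<Rightarrow> 'h) \<Rightarrow> complex" where
  "op_trace \<H> T = (\<Sum>\<^sub>\<infinity>b\<in>(SOME B. orthonormal_basis \<H> B). cinner \<H> b (T b))"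

definition quantum_state :: "'h hilbert \<Rightarrow> ('h \<Rightarrow> 'h) \<Rightarrow> bool" where
  "quantum_state \<H> \<rho> \<longleftrightarrow>
    positive_operator \<H> \<rho> \<and> trace_class \<H> \<rho> \<and> op_trace \<H> \<rho> = 1"

definition sums_to_identity :: "'h hilbert \<Rightarrow> ('v \<Rightarrow> 'h \<Rightarrow> 'h) \<Rightarrow> 'v set \<Rightarrow> bool" where
  "sums_to_identity \<H> P e \<longleftrightarrow> (\<forall>x\<in>carrier \<H>. (\<Oplus>\<^bsub>\<H>\<^esub>v\<in>e. P v x) = x)"

definition operators_commute :: "'h hilbert \<Rightarrow> ('h \<Rightarrow> 'h) \<Rightarrow> ('h \<Rightarrow> 'h) \<Rightarrow> bool" where
  "operators_commute \<H> S T \<longleftrightarrow> (\<forall>x\<in>carrier \<H>. S (T x) = T (S x))"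


section \<open>Quantum models\<close>

text \<open>The type argument is the universe from which the Hilbert space is taken.  A statement
  polymorphic in it covers Hilbert spaces of every size.\<close>

definition quantum_model :: "'h itself \<Rightarrow> 'v hypergraph \<Rightarrow> ('v \<Rightarrow> real) \<Rightarrow> bool" where
  "quantum_model (_ :: 'h itself) H p \<longleftrightarrow>
    p \<in> verts H \<rightarrow> {0..1} \<and>
    (\<exists>(\<H> :: 'h hilbert) \<rho> P.
       hilbert_space \<H> \<and> quantum_state \<H> \<rho> \<and>
       (\<forall>v\<in>verts H. projection \<H> (P v)) \<and>
       (\<forall>e\<in>edges H. sums_to_identity \<H> P e) \<and>
       (\<forall>v\<in>verts H. complex_of_real (p v) = op_trace \<H> (\<rho> \<circ> P v)))"

end

theory Submission
  imports Defs
begin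

text \<open>The Hilbert space and the state are the same on both sides. Commuting local projections
  multiply to joint ones. Conversely, projections that sum to the identity over an edge are
  pairwise orthogonal, so over subsets of an edge they sum to commuting projections. The local
  projections are the marginals \<open>PA u = (\<Sum>v\<in>eB. P (u, v))\<close> and \<open>PB v = (\<Sum>u\<in>eA. P (u, v))\<close>. The
  Foulis--Randall edges make them independent of \<open>eB\<close> and \<open>eA\<close>, so that for given \<open>u\<close> and \<open>v\<close> one
  may choose edges containing them, whence \<open>PA u * PB v = P (u, v)\<close>.\<close>

section \<open>Projections, their finite sums, and traces of operators equal on the carrier\<close>

definition operator_sum :: "'h hilbert \<Rightarrow> ('v \<Rightarrow> 'h \<Rightarrow> 'h) \<Rightarrow> 'v set \<Rightarrow> 'h \<Rightarrow> 'h" where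
  "operator_sum \<H> P D x = (\<Oplus>\<^bsub>\<H>\<^esub>v\<in>D. P v x)"

lemma projection_closed: "projection \<H> P \<Longrightarrow> x \<in> carrier \<H> \<Longrightarrow> P x \<in> carrier \<H>"
  by (auto simp: projection_def bounded_operator_def)

lemma projection_idem: "projection \<H> P \<Longrightarrow> x \<in> carrier \<H> \<Longrightarrow> P (P x) = P x"
  by (simp add: projection_def)

lemma projection_cinner:
  "projection \<H> P \<Longrightarrow> x \<in> carrier \<H> \<Longrightarrow> y \<in> carrier \<H> \<Longrightarrow> cinner \<H> (P x) y = cinner \<H> x (P y)"
  by (simp add: projection_def is_adjoint_def)

text \<open>\<open>op_trace\<close> sums over a basis picked by \<open>SOME\<close>, which is known
  to lie in the carrier only once some orthonormal basis exists. The state supplies one, being trace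
  class.\<close>

lemma quantum_state_op_trace_cong:
  assumes "quantum_state \<H> \<rho>" and "\<And>x. x \<in> carrier \<H> \<Longrightarrow> S x = T x"
  shows "op_trace \<H> S = op_trace \<H> T"
proof -
  have "\<exists>B. orthonormal_basis \<H> B"
    using assms(1) by (auto simp: quantum_state_def trace_class_def)
  then have "orthonormal_basis \<H> (SOME B. orthonormal_basis \<H> B)"
    by (rule someI_ex)
  then have "b \<in> carrier \<H>" if "b \<in> (SOME B. orthonormal_basis \<H> B)" for b
    using that unfolding orthonormal_basis_def[of \<H> "SOME B. orthonormal_basis \<H> B"] by blast
  then show ?thesis
    unfolding op_trace_def by (intro infsum_cong arg_cong2[where f = "cinner \<H>"] refl assms(2))
qed

section \<open>Inner products and a criterion for projections\<close>

context hilbert_space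
begin

lemma scale_closed: "x \<in> carrier \<H> \<Longrightarrow> c \<odot>\<^bsub>\<H>\<^esub> x \<in> carrier \<H>"
  by (rule smult_closed) (simp_all add: complex_ring_def)

lemma cinner_zero_right: "z \<in> carrier \<H> \<Longrightarrow> cinner \<H> z \<zero>\<^bsub>\<H>\<^esub> = 0"
  using cinner_add_right[of z "\<zero>\<^bsub>\<H>\<^esub>" "\<zero>\<^bsub>\<H>\<^esub>"] by simp

lemma diff_add_cancel:
  "x \<in> carrier \<H> \<Longrightarrow> y \<in> carrier \<H> \<Longrightarrow> (x \<ominus>\<^bsub>\<H>\<^esub> y) \<oplus>\<^bsub>\<H>\<^esub> y = x"
  by (simp add: M.minus_eq M.a_assoc M.l_neg)

lemma cinner_diff_right:
  assumes "z \<in> carrier \<H>" "x \<in> carrier \<H>" "y \<in> carrier \<H>"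
  shows "cinner \<H> z (x \<ominus>\<^bsub>\<H>\<^esub> y) = cinner \<H> z x - cinner \<H> z y"
  using cinner_add_right[of z "x \<ominus>\<^bsub>\<H>\<^esub> y" y] assms by (simp add: diff_add_cancel)

lemma cinner_finsum_right:
  assumes "finite D" and "\<And>v. v \<in> D \<Longrightarrow> f v \<in> carrier \<H>" and "z \<in> carrier \<H>"
  shows "cinner \<H> z (\<Oplus>\<^bsub>\<H>\<^esub>v\<in>D. f v) = (\<Sum>v\<in>D. cinner \<H> z (f v))"
  using assms
  by (induction D rule: finite_induct)
     (auto simp: cinner_zero_right cinner_add_right Pi_iff)

text \<open>Testing with \<open>z\<close> the difference of \<open>x\<close> and \<open>y\<close>
  makes its square norm vanish. This reduces identities between operators to identities between
  complex numbers.\<close>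

lemma vector_eqI:
  assumes "x \<in> carrier \<H>" "y \<in> carrier \<H>"
    and "\<And>z. z \<in> carrier \<H> \<Longrightarrow> cinner \<H> z x = cinner \<H> z y"
  shows "x = y"
proof -
  have "x \<ominus>\<^bsub>\<H>\<^esub> y = \<zero>\<^bsub>\<H>\<^esub>"
    using assms by (intro cinner_definite) (simp_all add: cinner_diff_right)
  then show ?thesis
    using diff_add_cancel[OF assms(1,2)] assms(2) by simp
qed

text \<open>Linearity follows from self-adjointness; boundedness by 1 is Pythagoras for
  \<open>x = T x + (x - T x)\<close>.\<close>

lemma projectionI:
  assumes closed: "\<And>x. x \<in> carrier \<H> \<Longrightarrow> T x \<in> carrier \<H>"
    and idem: "\<And>x. x \<in> carrier \<H> \<Longrightarrow> T (T x) = T x"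
    and adj: "\<And>x y. x \<in> carrier \<H> \<Longrightarrow> y \<in> carrier \<H> \<Longrightarrow> cinner \<H> (T x) y = cinner \<H> x (T y)"
  shows "projection \<H> T"
proof -
  have add: "T (x \<oplus>\<^bsub>\<H>\<^esub> y) = T x \<oplus>\<^bsub>\<H>\<^esub> T y" if "x \<in> carrier \<H>" "y \<in> carrier \<H>" for x y
    using that by (intro vector_eqI) (simp_all add: closed cinner_add_right flip: adj)
  have smult: "T (c \<odot>\<^bsub>\<H>\<^esub> x) = c \<odot>\<^bsub>\<H>\<^esub> T x" if "x \<in> carrier \<H>" for c x
    using that by (intro vector_eqI) (simp_all add: closed scale_closed cinner_smult_right flip: adj)
  \<comment> \<open>The factor 1 stays explicit to match the bound in
    \<open>bounded_operator\<close>, where 1 is later the witness for the constant.\<close>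
  have bound: "hnorm \<H> (T x) \<le> 1 * hnorm \<H> x" if x: "x \<in> carrier \<H>" for x
  proof -
    define d where "d = x \<ominus>\<^bsub>\<H>\<^esub> T x"
    have d: "d \<in> carrier \<H>"
      using x by (simp add: d_def closed)
    \<comment> \<open>Moving \<open>T\<close> to the right turns both terms into
      \<open>cinner \<H> x (T x)\<close>, the second one by idempotence.\<close>
    have "cinner \<H> (T x) d = 0"
      using x by (simp add: d_def cinner_diff_right closed adj idem)
    then have dT: "cinner \<H> d (T x) = 0"
      using cinner_commute[of "T x" d] d x by (simp add: closed)
    have "cinner \<H> d d = cinner \<H> d x"
      using dT cinner_diff_right[OF d x closed[OF x]] by (simp add: d_def)
    \<comment> \<open>The difference is expanded in the second argument, so the arguments are
      exchanged first. The conjugation is harmless, as only real parts are compared in the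
      end.\<close>
    also have "\<dots> = cnj (cinner \<H> x d)"
      using cinner_commute d x by blast
    also have "cinner \<H> x d = cinner \<H> x x - cinner \<H> (T x) (T x)"
      using x by (simp add: d_def cinner_diff_right closed adj idem)
    finally have "Re (cinner \<H> (T x) (T x)) + Re (cinner \<H> d d) = Re (cinner \<H> x x)"
      by simp
    moreover have "Re (cinner \<H> d d) \<ge> 0"
      using cinner_nonneg[OF d] by (simp add: complex_nonneg_Reals_iff)
    ultimately show ?thesis
      by (simp add: hnorm_def)
  qed
  show ?thesis
    unfolding projection_def bounded_operator_def is_adjoint_def
    by (intro conjI ballI allI Pi_I exI[of _ 1]) (rule closed add smult bound idem adj; assumption)+
qed

text \<open>Commutation gives \<open>PQPQ = PPQQ = PQ\<close>, and the adjoint of \<open>PQ\<close>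
  is \<open>QP = PQ\<close>.\<close>

lemma projection_compose:
  assumes P: "projection \<H> P" and Q: "projection \<H> Q" and comm: "operators_commute \<H> P Q"
  shows "projection \<H> (\<lambda>x. P (Q x))"
proof (rule projectionI)
  fix x assume x: "x \<in> carrier \<H>"
  show "P (Q x) \<in> carrier \<H>"
    using P Q x by (simp add: projection_closed)
  have "P (Q (P (Q x))) = P (P (Q (Q x)))"
    using comm P Q x by (simp add: operators_commute_def projection_closed)
  then show "P (Q (P (Q x))) = P (Q x)"
    using P Q x by (simp add: projection_closed projection_idem)
  fix y assume y: "y \<in> carrier \<H>"
  have "cinner \<H> (P (Q x)) y = cinner \<H> x (Q (P y))"
    using P Q x y by (simp add: projection_closed projection_cinner)
  then show "cinner \<H> (P (Q x)) y = cinner \<H> x (P (Q y))"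
    using comm y by (simp add: operators_commute_def)
qed

section \<open>Sums of projections over subsets of an edge\<close>

lemma operator_sum_closed:
  assumes "\<And>v. v \<in> D \<Longrightarrow> projection \<H> (P v)" and "x \<in> carrier \<H>"
  shows "operator_sum \<H> P D x \<in> carrier \<H>"
  using assms unfolding operator_sum_def
  by (intro M.finsum_closed) (auto simp: projection_closed)

lemma cinner_operator_sum:
  assumes "finite D" and "\<And>v. v \<in> D \<Longrightarrow> projection \<H> (P v)"
    and "x \<in> carrier \<H>" and "z \<in> carrier \<H>"
  shows "cinner \<H> z (operator_sum \<H> P D x) = (\<Sum>v\<in>D. cinner \<H> z (P v x))"
  using assms unfolding operator_sum_def
  by (intro cinner_finsum_right) (auto simp: projection_closed)

text \<open>The weak form of a resolution of the identity: module sums become sums of complex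
  numbers, which can be split, regrouped and cancelled.\<close>

lemma sums_to_identity_iff:
  assumes "finite e" and "\<And>v. v \<in> e \<Longrightarrow> projection \<H> (P v)"
  shows "sums_to_identity \<H> P e \<longleftrightarrow>
    (\<forall>x\<in>carrier \<H>. \<forall>z\<in>carrier \<H>. (\<Sum>v\<in>e. cinner \<H> z (P v x)) = cinner \<H> z x)"
proof -
  have "operator_sum \<H> P e x = x \<longleftrightarrow>
      (\<forall>z\<in>carrier \<H>. (\<Sum>v\<in>e. cinner \<H> z (P v x)) = cinner \<H> z x)" if "x \<in> carrier \<H>" for x
    using that vector_eqI[of "operator_sum \<H> P e x" x] cinner_operator_sum[of e P x]
      operator_sum_closed[of e P x] assms by metis
  then show ?thesis
    by (auto simp: sums_to_identity_def operator_sum_def)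
qed

text \<open>For \<open>y = P w x\<close> the identity \<open>\<parallel>y\<parallel>\<^sup>2 = (\<Sum>u\<in>e. \<parallel>P u y\<parallel>\<^sup>2)\<close> leaves no room for the terms
  with \<open>u \<noteq> w\<close>.\<close>

lemma projections_orthogonal:
  assumes fin: "finite e" and P: "\<And>v. v \<in> e \<Longrightarrow> projection \<H> (P v)"
    and id: "sums_to_identity \<H> P e"
    and v: "v \<in> e" and w: "w \<in> e" and vw: "v \<noteq> w" and x: "x \<in> carrier \<H>"
  shows "P v (P w x) = \<zero>\<^bsub>\<H>\<^esub>"
proof -
  define y where "y = P w x"
  have y: "y \<in> carrier \<H>"
    using P w x by (simp add: y_def projection_closed)
  have sq: "cinner \<H> (P u y) (P u y) = cinner \<H> y (P u y)" if "u \<in> e" for u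
    using P[OF that] y by (simp add: projection_closed projection_cinner projection_idem)
  have nonneg: "cinner \<H> (P u y) (P u y) \<in> \<real>\<^sub>\<ge>\<^sub>0" if "u \<in> e" for u
    using P[OF that] y by (simp add: projection_closed cinner_nonneg)
  have "cinner \<H> y y = (\<Sum>u\<in>e. cinner \<H> y (P u y))"
    using sums_to_identity_iff[OF fin P] id y by simp
  also have "\<dots> = (\<Sum>u\<in>e. cinner \<H> (P u y) (P u y))"
    by (simp add: sq)
  \<comment> \<open>The term \<open>u = w\<close> equals \<open>cinner \<H> y y\<close> because
    \<open>P w\<close> fixes \<open>y\<close>, so the remaining terms must add up to zero.\<close>
  also have "\<dots> = cinner \<H> y y + (\<Sum>u\<in>e - {w}. cinner \<H> (P u y) (P u y))"
    using fin w P x by (simp add: sum.remove[of e w] y_def projection_idem[OF P])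
  finally have "(\<Sum>u\<in>e - {w}. cinner \<H> (P u y) (P u y)) = 0"
    by simp
  \<comment> \<open>Real parts are taken because a sum of nonnegative reals vanishes only if every
    term does.\<close>
  then have "(\<Sum>u\<in>e - {w}. Re (cinner \<H> (P u y) (P u y))) = 0"
    by (metis Re_sum zero_complex.sel(1))
  then have "Re (cinner \<H> (P v y) (P v y)) = 0"
    using fin v vw nonneg
    by (subst (asm) sum_nonneg_eq_0_iff) (auto simp: complex_nonneg_Reals_iff)
  then have "cinner \<H> (P v y) (P v y) = 0"
    using nonneg[OF v] by (simp add: complex_nonneg_Reals_iff complex_eq_iff)
  then show ?thesis
    using cinner_definite P[OF v] y by (simp add: projection_closed y_def)
qed

text \<open>Expanding the product gives terms \<open>P v (P w x)\<close> with \<open>v\<close> in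
  \<open>D\<close> and \<open>w\<close> in \<open>D'\<close>. Orthogonality kills those with
  distinct indices and idempotence simplifies the others, leaving the indices in both sets.\<close>

lemma operator_sum_compose:
  assumes fin: "finite e" and P: "\<And>v. v \<in> e \<Longrightarrow> projection \<H> (P v)"
    and id: "sums_to_identity \<H> P e"
    and D: "D \<subseteq> e" and D': "D' \<subseteq> e" and x: "x \<in> carrier \<H>"
  shows "operator_sum \<H> P D (operator_sum \<H> P D' x) = operator_sum \<H> P (D \<inter> D') x"
proof (rule vector_eqI)
  have finD: "finite D" "finite D'"
    using D D' fin finite_subset by blast+
  have PD: "projection \<H> (P v)" if "v \<in> D \<union> D'" for v
    using that P D D' by blast
  have closed: "operator_sum \<H> P D' x \<in> carrier \<H>"
    using x PD by (intro operator_sum_closed) auto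
  then show "operator_sum \<H> P D (operator_sum \<H> P D' x) \<in> carrier \<H>"
    using PD by (rule operator_sum_closed[rotated]) auto
  show "operator_sum \<H> P (D \<inter> D') x \<in> carrier \<H>"
    using x PD by (intro operator_sum_closed) auto
  fix z assume z: "z \<in> carrier \<H>"
  have term_eq: "cinner \<H> z (P v (P w x)) = (if v = w then cinner \<H> z (P v x) else 0)"
    if "v \<in> D" "w \<in> D'" for v w
  proof (cases "v = w")
    case True
    then show ?thesis
      using projection_idem[OF PD x] that by simp
  next
    case False
    then have "P v (P w x) = \<zero>\<^bsub>\<H>\<^esub>"
      using that D D' x by (intro projections_orthogonal[OF fin P id]) auto
    then show ?thesis
      using False z by (simp add: cinner_zero_right)
  qed
  have "cinner \<H> z (operator_sum \<H> P D (operator_sum \<H> P D' x))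
      = (\<Sum>v\<in>D. cinner \<H> z (P v (operator_sum \<H> P D' x)))"
    using finD PD x z by (simp add: cinner_operator_sum operator_sum_closed)
  also have "\<dots> = (\<Sum>v\<in>D. \<Sum>w\<in>D'. cinner \<H> z (P v (P w x)))"
  proof (rule sum.cong)
    fix v assume v: "v \<in> D"
    \<comment> \<open>\<open>P v\<close> is moved to the left argument while the inner sum is
      expanded, then moved back; this avoids pulling \<open>P v\<close> through a module
      sum.\<close>
    have "cinner \<H> z (P v (operator_sum \<H> P D' x)) = (\<Sum>w\<in>D'. cinner \<H> (P v z) (P w x))"
      using finD PD x z v
      by (simp add: cinner_operator_sum operator_sum_closed projection_closed
          flip: projection_cinner[of \<H> "P v"])
    also have "\<dots> = (\<Sum>w\<in>D'. cinner \<H> z (P v (P w x)))"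
      using PD x z v by (intro sum.cong) (auto simp: projection_closed projection_cinner)
    finally show "cinner \<H> z (P v (operator_sum \<H> P D' x)) = (\<Sum>w\<in>D'. cinner \<H> z (P v (P w x)))" .
  qed simp
  also have "\<dots> = (\<Sum>v\<in>D. if v \<in> D' then cinner \<H> z (P v x) else 0)"
    using finD by (intro sum.cong) (simp_all add: term_eq sum.delta')
  also have "\<dots> = (\<Sum>v\<in>D \<inter> D'. cinner \<H> z (P v x))"
    using finD by (simp add: sum.inter_restrict)
  also have "\<dots> = cinner \<H> z (operator_sum \<H> P (D \<inter> D') x)"
    using finD PD x z by (intro cinner_operator_sum[symmetric]) auto
  finally show "cinner \<H> z (operator_sum \<H> P D (operator_sum \<H> P D' x))
      = cinner \<H> z (operator_sum \<H> P (D \<inter> D') x)" .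
qed

text \<open>Idempotence is the composition rule with both subsets equal to \<open>D\<close>;
  self-adjointness holds term by term.\<close>

lemma projection_operator_sum:
  assumes fin: "finite e" and P: "\<And>v. v \<in> e \<Longrightarrow> projection \<H> (P v)"
    and id: "sums_to_identity \<H> P e" and D: "D \<subseteq> e"
  shows "projection \<H> (operator_sum \<H> P D)"
proof (rule projectionI)
  have finD: "finite D"
    using D fin finite_subset by blast
  have PD: "projection \<H> (P v)" if "v \<in> D" for v
    using that P D by blast
  fix x assume x: "x \<in> carrier \<H>"
  show closed: "operator_sum \<H> P D x \<in> carrier \<H>"
    using x PD by (simp add: operator_sum_closed)
  show "operator_sum \<H> P D (operator_sum \<H> P D x) = operator_sum \<H> P D x"
    using operator_sum_compose[OF fin P id D D x] by simp
  fix y assume y: "y \<in> carrier \<H>"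
  have "cinner \<H> (operator_sum \<H> P D x) y = cnj (\<Sum>v\<in>D. cinner \<H> y (P v x))"
    using cinner_commute[OF y closed] finD PD x y by (simp add: cinner_operator_sum)
  also have "\<dots> = (\<Sum>v\<in>D. cinner \<H> (P v x) y)"
    using PD x y by (auto simp: projection_closed intro!: sum.cong cinner_commute[symmetric])
  also have "\<dots> = cinner \<H> x (operator_sum \<H> P D y)"
    using finD PD x y by (simp add: cinner_operator_sum projection_cinner)
  finally show "cinner \<H> (operator_sum \<H> P D x) y = cinner \<H> x (operator_sum \<H> P D y)" .
qed

lemma operator_sum_singleton:
  "projection \<H> (P v) \<Longrightarrow> x \<in> carrier \<H> \<Longrightarrow> operator_sum \<H> P {v} x = P v x"
  unfolding operator_sum_def by (simp add: projection_closed)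

text \<open>Both sums equal the identity minus the sum over \<open>C\<close>. This makes a marginal
  independent of the edge over which it is taken.\<close>

lemma operator_sum_eq_of_common_complement:
  assumes fin: "finite (D \<union> C)" "finite (D' \<union> C)"
    and P: "\<And>v. v \<in> D \<union> D' \<union> C \<Longrightarrow> projection \<H> (P v)"
    and disj: "D \<inter> C = {}" "D' \<inter> C = {}"
    and id: "sums_to_identity \<H> P (D \<union> C)" "sums_to_identity \<H> P (D' \<union> C)"
    and x: "x \<in> carrier \<H>"
  shows "operator_sum \<H> P D x = operator_sum \<H> P D' x"
proof (rule vector_eqI)
  show "operator_sum \<H> P D x \<in> carrier \<H>" "operator_sum \<H> P D' x \<in> carrier \<H>"
    using P x by (simp_all add: operator_sum_closed)
  fix z assume z: "z \<in> carrier \<H>"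
  have "(\<Sum>v\<in>D \<union> C. cinner \<H> z (P v x)) = (\<Sum>v\<in>D' \<union> C. cinner \<H> z (P v x))"
    using sums_to_identity_iff[OF fin(1), of P] sums_to_identity_iff[OF fin(2), of P] P id x z
    by auto
  then have "(\<Sum>v\<in>D. cinner \<H> z (P v x)) = (\<Sum>v\<in>D'. cinner \<H> z (P v x))"
    using fin disj by (simp add: sum.union_disjoint)
  then show "cinner \<H> z (operator_sum \<H> P D x) = cinner \<H> z (operator_sum \<H> P D' x)"
    using fin P x z by (simp add: cinner_operator_sum)
qed

section \<open>Resolutions of the identity: products, coordinate flips and coarsenings\<close>

text \<open>For fixed \<open>i\<close> the sum over \<open>j\<close> is carried out first, with
  \<open>Q i\<close> moved to the left argument, so the inner family \<open>f i\<close> may vary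
  with \<open>i\<close>. This is the shape of a Foulis--Randall edge.\<close>

lemma sums_to_identity_Sigma:
  assumes fin: "finite I" "\<And>i. i \<in> I \<Longrightarrow> finite (f i)"
    and Q: "\<And>i. i \<in> I \<Longrightarrow> projection \<H> (Q i)"
    and R: "\<And>i j. i \<in> I \<Longrightarrow> j \<in> f i \<Longrightarrow> projection \<H> (R j)"
    and QR: "\<And>i j. i \<in> I \<Longrightarrow> j \<in> f i \<Longrightarrow> operators_commute \<H> (Q i) (R j)"
    and idQ: "sums_to_identity \<H> Q I"
    and idR: "\<And>i. i \<in> I \<Longrightarrow> sums_to_identity \<H> R (f i)"
  shows "sums_to_identity \<H> (\<lambda>(i, j) x. Q i (R j x)) (Sigma I f)"
proof -
  have "(\<Sum>w\<in>Sigma I f. cinner \<H> z ((\<lambda>(i, j) x. Q i (R j x)) w x)) = cinner \<H> z x"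
    if x: "x \<in> carrier \<H>" and z: "z \<in> carrier \<H>" for x z
  proof -
    have "(\<Sum>w\<in>Sigma I f. cinner \<H> z ((\<lambda>(i, j) x. Q i (R j x)) w x))
        = (\<Sum>i\<in>I. \<Sum>j\<in>f i. cinner \<H> z (Q i (R j x)))"
      using fin by (simp add: sum.Sigma split_def)
    also have "\<dots> = (\<Sum>i\<in>I. \<Sum>j\<in>f i. cinner \<H> (Q i z) (R j x))"
      using Q R x z by (intro sum.cong) (auto simp: projection_closed projection_cinner)
    also have "\<dots> = (\<Sum>i\<in>I. cinner \<H> (Q i z) x)"
    proof (rule sum.cong)
      fix i assume i: "i \<in> I"
      show "(\<Sum>j\<in>f i. cinner \<H> (Q i z) (R j x)) = cinner \<H> (Q i z) x"
        using sums_to_identity_iff[OF fin(2)[OF i], of R] R i idR Q x z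
        by (simp add: projection_closed)
    qed simp
    also have "\<dots> = (\<Sum>i\<in>I. cinner \<H> z (Q i x))"
      using Q x z by (intro sum.cong) (auto simp: projection_cinner)
    also have "\<dots> = cinner \<H> z x"
      using sums_to_identity_iff[OF fin(1), of Q] Q idQ x z by simp
    finally show ?thesis .
  qed
  \<comment> \<open>Commutation enters here: it makes the products projections, as the weak
    criterion for the identity requires.\<close>
  moreover have "projection \<H> ((\<lambda>(i, j) x. Q i (R j x)) w)" if "w \<in> Sigma I f" for w
    using that Q R QR projection_compose[of "Q (fst w)" "R (snd w)"] by (auto simp: split_def)
  ultimately show ?thesis
    using fin by (subst sums_to_identity_iff) auto
qed

text \<open>Reindexing along the injective \<open>prod.swap\<close>. It carries a result about a
  \<open>Sigma\<close> set over to edges of the second kind, whose fibres lie over the second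
  coordinate.\<close>

lemma sums_to_identity_swap:
  assumes fin: "finite e" and P: "\<And>i j. (i, j) \<in> e \<Longrightarrow> projection \<H> (P (i, j))"
    and P': "\<And>i j x. (i, j) \<in> e \<Longrightarrow> x \<in> carrier \<H> \<Longrightarrow> P' (j, i) x = P (i, j) x"
    and id: "sums_to_identity \<H> P e"
  shows "sums_to_identity \<H> P' (prod.swap ` e)"
  unfolding sums_to_identity_def
proof
  fix x assume x: "x \<in> carrier \<H>"
  have "(\<Oplus>\<^bsub>\<H>\<^esub>v\<in>prod.swap ` e. P' v x) = (\<Oplus>\<^bsub>\<H>\<^esub>v\<in>e. P' (prod.swap v) x)"
    using P P' x by (intro M.finsum_reindex) (auto simp: projection_closed)
  also have "\<dots> = (\<Oplus>\<^bsub>\<H>\<^esub>v\<in>e. P v x)"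
    using P P' x by (intro M.finsum_cong') (auto simp: projection_closed)
  also have "\<dots> = x"
    using id x by (simp add: sums_to_identity_def)
  finally show "(\<Oplus>\<^bsub>\<H>\<^esub>v\<in>prod.swap ` e. P' v x) = x" .
qed

text \<open>Summing first within the disjoint blocks \<open>D i\<close> and then over
  \<open>i\<close> regroups the given resolution of the identity. The marginals arise this way from
  a product edge.\<close>

lemma sums_to_identity_blocks:
  assumes fin: "finite I" "\<And>i. i \<in> I \<Longrightarrow> finite (D i)" and disj: "disjoint_family_on D I"
    and P: "\<And>v. v \<in> (\<Union>i\<in>I. D i) \<Longrightarrow> projection \<H> (P v)"
    and Q: "\<And>i x. i \<in> I \<Longrightarrow> x \<in> carrier \<H> \<Longrightarrow> Q i x = operator_sum \<H> P (D i) x"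
    and id: "sums_to_identity \<H> P (\<Union>i\<in>I. D i)"
  shows "sums_to_identity \<H> Q I"
  unfolding sums_to_identity_def
proof
  fix x assume x: "x \<in> carrier \<H>"
  have closed: "Q i x \<in> carrier \<H>" if "i \<in> I" for i
    using Q that x operator_sum_closed[of "D i" P x] P by auto
  show "(\<Oplus>\<^bsub>\<H>\<^esub>i\<in>I. Q i x) = x"
  proof (rule vector_eqI)
    show "(\<Oplus>\<^bsub>\<H>\<^esub>i\<in>I. Q i x) \<in> carrier \<H>"
      using closed by (intro M.finsum_closed) auto
    fix z assume z: "z \<in> carrier \<H>"
    have "cinner \<H> z (\<Oplus>\<^bsub>\<H>\<^esub>i\<in>I. Q i x) = (\<Sum>i\<in>I. cinner \<H> z (operator_sum \<H> P (D i) x))"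
      using cinner_finsum_right[of I "\<lambda>i. Q i x" z] fin closed z Q x by simp
    also have "\<dots> = (\<Sum>i\<in>I. \<Sum>v\<in>D i. cinner \<H> z (P v x))"
      using fin P x z by (intro sum.cong cinner_operator_sum) auto
    also have "\<dots> = (\<Sum>v\<in>(\<Union>i\<in>I. D i). cinner \<H> z (P v x))"
      using fin disj by (subst sum.UNION_disjoint) (auto simp: disjoint_family_on_def)
    also have "\<dots> = cinner \<H> z x"
      using sums_to_identity_iff[of "\<Union>i\<in>I. D i" P] fin P id x z by simp
    finally show "cinner \<H> z (\<Oplus>\<^bsub>\<H>\<^esub>i\<in>I. Q i x) = cinner \<H> z x" .
  qed (rule x)
qed

end

section \<open>Edges of the Foulis--Randall product\<close>

lemma foulis_randall_edgeI1:
  assumes "eA \<in> edges HA" and "f \<in> eA \<rightarrow> edges HB"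
  shows "Sigma eA f \<in> edges (HA \<otimes>\<^sub>F\<^sub>R HB)"
  using assms unfolding foulis_randall_def Sigma_def by fastforce

lemma foulis_randall_edgeI2:
  assumes "eB \<in> edges HB" and "f \<in> eB \<rightarrow> edges HA"
  shows "(\<Union>b\<in>eB. f b \<times> {b}) \<in> edges (HA \<otimes>\<^sub>F\<^sub>R HB)"
  using assms unfolding foulis_randall_def by auto

text \<open>Edges of the second kind are presented as flipped \<open>Sigma\<close> sets, so that one
  computation over \<open>Sigma\<close> serves both kinds.\<close>

lemma foulis_randall_edge_cases:
  assumes "e \<in> edges (HA \<otimes>\<^sub>F\<^sub>R HB)"
  obtains (left) eA f where "e = Sigma eA f" "eA \<in> edges HA" "f \<in> eA \<rightarrow> edges HB"
    | (right) eB f where "e = prod.swap ` Sigma eB f" "eB \<in> edges HB" "f \<in> eB \<rightarrow> edges HA"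
proof -
  have "(\<Union>a\<in>eA. {a} \<times> f a) = Sigma eA f" for eA and f :: "'a \<Rightarrow> 'b set"
    by auto
  moreover have "(\<Union>b\<in>eB. f b \<times> {b}) = prod.swap ` Sigma eB f" for eB and f :: "'b \<Rightarrow> 'a set"
    by force
  ultimately show thesis
    using assms that unfolding foulis_randall_def by auto
qed

lemma verts_foulis_randall: "verts (HA \<otimes>\<^sub>F\<^sub>R HB) = verts HA \<times> verts HB"
  by (simp add: foulis_randall_def)

context contextuality_scenario
begin

lemma edge_subset: "e \<in> edges H \<Longrightarrow> e \<subseteq> verts H"
  using edges_subset by auto

lemma edge_finite: "e \<in> edges H \<Longrightarrow> finite e"
  using edge_subset finite_verts finite_subset by blast

lemma obtain_edge:
  assumes "v \<in> verts H" obtains e where "e \<in> edges H" "v \<in> e"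
  using assms edges_cover by blast

end

section \<open>From commuting local projections to joint ones\<close>

text \<open>An edge of the first kind is a \<open>Sigma\<close> set over an edge of
  \<open>HA\<close>. For the second kind the roles of \<open>HA\<close> and \<open>HB\<close> are
  exchanged, the result is flipped, and commutation restores the order of the factors.\<close>

lemma local_imp_joint:
  assumes HA: "contextuality_scenario HA" and HB: "contextuality_scenario HB"
    and H: "hilbert_space \<H>"
    and PA: "\<And>u. u \<in> verts HA \<Longrightarrow> projection \<H> (PA u)"
    and PB: "\<And>v. v \<in> verts HB \<Longrightarrow> projection \<H> (PB v)"
    and idA: "\<And>eA. eA \<in> edges HA \<Longrightarrow> sums_to_identity \<H> PA eA"
    and idB: "\<And>eB. eB \<in> edges HB \<Longrightarrow> sums_to_identity \<H> PB eB"
    and comm: "\<And>u v. u \<in> verts HA \<Longrightarrow> v \<in> verts HB \<Longrightarrow> operators_commute \<H> (PA u) (PB v)"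
    and e: "e \<in> edges (HA \<otimes>\<^sub>F\<^sub>R HB)"
  shows "sums_to_identity \<H> (\<lambda>(u, v) x. PA u (PB v x)) e"
proof -
  interpret A: contextuality_scenario HA by fact
  interpret B: contextuality_scenario HB by fact
  interpret hilbert_space \<H> by fact
  have comm': "operators_commute \<H> (PB v) (PA u)" if "u \<in> verts HA" "v \<in> verts HB" for u v
    using comm[OF that] by (simp add: operators_commute_def)
  from e show ?thesis
  proof (cases rule: foulis_randall_edge_cases)
    case (left eA f)
    have f: "f a \<in> edges HB" "f a \<subseteq> verts HB" "finite (f a)" if "a \<in> eA" for a
      using that left B.edge_subset B.edge_finite by auto
    have eA: "eA \<subseteq> verts HA" "finite eA"
      using left A.edge_subset A.edge_finite by auto
    show ?thesis
      unfolding left(1)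
      by (rule sums_to_identity_Sigma)
        (blast intro: PA PB comm idA idB left(2) f(1,3) eA(2) subsetD[OF f(2)] subsetD[OF eA(1)])+
  next
    case (right eB f)
    have f: "f b \<in> edges HA" "f b \<subseteq> verts HA" "finite (f b)" if "b \<in> eB" for b
      using that right A.edge_subset A.edge_finite by auto
    have eB: "eB \<subseteq> verts HB" "finite eB"
      using right B.edge_subset B.edge_finite by auto
    have id: "sums_to_identity \<H> (\<lambda>(v, u) x. PB v (PA u x)) (Sigma eB f)"
      by (rule sums_to_identity_Sigma)
        (blast intro: PA PB comm' idA idB right(2) f(1,3) eB(2) subsetD[OF f(2)] subsetD[OF eB(1)])+
    show ?thesis
      unfolding right(1)
    proof (rule sums_to_identity_swap[OF _ _ _ id])
      show "finite (Sigma eB f)"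
        using eB f by auto
      fix i j assume ij: "(i, j) \<in> Sigma eB f"
      then have V: "i \<in> verts HB" "j \<in> verts HA"
        using f eB by auto
      then show "projection \<H> ((\<lambda>(v, u) x. PB v (PA u x)) (i, j))"
        using projection_compose PA PB comm' by simp
      show "(\<lambda>(u, v) x. PA u (PB v x)) (j, i) x = (\<lambda>(v, u) x. PB v (PA u x)) (i, j) x"
        if "x \<in> carrier \<H>" for x
        using comm[OF V(2,1)] that by (simp add: operators_commute_def)
    qed
  qed
qed

section \<open>From joint projections to commuting marginals\<close>

lemma joint_imp_local:
  assumes HA: "contextuality_scenario HA" and HB: "contextuality_scenario HB"
    and H: "hilbert_space \<H>"
    and P: "\<And>w. w \<in> verts (HA \<otimes>\<^sub>F\<^sub>R HB) \<Longrightarrow> projection \<H> (P w)"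
    and id: "\<And>e. e \<in> edges (HA \<otimes>\<^sub>F\<^sub>R HB) \<Longrightarrow> sums_to_identity \<H> P e"
  obtains PA PB where
    "\<forall>u\<in>verts HA. projection \<H> (PA u)"
    "\<forall>v\<in>verts HB. projection \<H> (PB v)"
    "\<forall>eA\<in>edges HA. sums_to_identity \<H> PA eA"
    "\<forall>eB\<in>edges HB. sums_to_identity \<H> PB eB"
    "\<forall>u\<in>verts HA. \<forall>v\<in>verts HB. operators_commute \<H> (PA u) (PB v)"
    "\<forall>u\<in>verts HA. \<forall>v\<in>verts HB. \<forall>x\<in>carrier \<H>. PA u (PB v x) = P (u, v) x"
proof -
  interpret A: contextuality_scenario HA by fact
  interpret B: contextuality_scenario HB by fact
  interpret hilbert_space \<H> by fact
  \<comment> \<open>Reference edges used to define the marginals; they exist because the vertex sets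
    are nonempty and covered by edges.\<close>
  obtain eA0 where eA0: "eA0 \<in> edges HA"
    using A.verts_nonempty A.edges_cover by blast
  obtain eB0 where eB0: "eB0 \<in> edges HB"
    using B.verts_nonempty B.edges_cover by blast
  define PA where "PA u = operator_sum \<H> P ({u} \<times> eB0)" for u
  define PB where "PB v = operator_sum \<H> P (eA0 \<times> {v})" for v
  have P': "projection \<H> (P (u, v))" if "u \<in> verts HA" "v \<in> verts HB" for u v
    using P that by (simp add: verts_foulis_randall)
  have prod_edge: "eA \<times> eB \<in> edges (HA \<otimes>\<^sub>F\<^sub>R HB)" if "eA \<in> edges HA" "eB \<in> edges HB" for eA eB
    using foulis_randall_edgeI1[of eA HA "\<lambda>_. eB" HB] that by simp
  have P_edge: "projection \<H> (P w)" if "eA \<in> edges HA" "eB \<in> edges HB" "w \<in> eA \<times> eB" for eA eB w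
    using P' that A.edge_subset B.edge_subset by blast
  have fin_prod: "finite (eA \<times> eB)" if "eA \<in> edges HA" "eB \<in> edges HB" for eA eB
    using that A.edge_finite B.edge_finite by simp
  \<comment> \<open>Bundled in the order of the first three premises of
    \<open>operator_sum_compose\<close> and \<open>projection_operator_sum\<close>.\<close>
  note edge = fin_prod P_edge id[OF prod_edge]

  \<comment> \<open>In the edge \<open>eA \<times> eB0\<close> with \<open>u\<close> in
    \<open>eA\<close>, replacing the fibre over \<open>u\<close> by \<open>eB\<close> gives another
    edge of the first kind. The two share everything outside that fibre.\<close>
  have PA_eq: "PA u x = operator_sum \<H> P ({u} \<times> eB) x"
    if u: "u \<in> verts HA" and eB: "eB \<in> edges HB" and x: "x \<in> carrier \<H>" for u eB x
  proof -
    obtain eA where eA: "eA \<in> edges HA" "u \<in> eA"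
      using u by (rule A.obtain_edge)
    let ?C = "(eA - {u}) \<times> eB0"
    have E: "{u} \<times> eB0 \<union> ?C = eA \<times> eB0"
      "{u} \<times> eB \<union> ?C = Sigma eA (\<lambda>a. if a = u then eB else eB0)"
      using eA by (auto split: if_splits)
    show ?thesis
      unfolding PA_def
    proof (rule operator_sum_eq_of_common_complement[where C = ?C])
      show "finite ({u} \<times> eB0 \<union> ?C)" "finite ({u} \<times> eB \<union> ?C)"
        using eA eB eB0 A.edge_finite B.edge_finite by auto
      show "sums_to_identity \<H> P ({u} \<times> eB0 \<union> ?C)"
        unfolding E using eA eB0 by (intro id prod_edge)
      show "sums_to_identity \<H> P ({u} \<times> eB \<union> ?C)"
        unfolding E using eA eB eB0 by (intro id foulis_randall_edgeI1) auto
    qed (use eA eB eB0 x P' A.edge_subset B.edge_subset in blast)+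
  qed
  \<comment> \<open>The mirror image, where the fibre over \<open>v\<close> is replaced and the new
    edge is of the second kind.\<close>
  have PB_eq: "PB v x = operator_sum \<H> P (eA \<times> {v}) x"
    if v: "v \<in> verts HB" and eA: "eA \<in> edges HA" and x: "x \<in> carrier \<H>" for v eA x
  proof -
    obtain eB where eB: "eB \<in> edges HB" "v \<in> eB"
      using v by (rule B.obtain_edge)
    let ?C = "eA0 \<times> (eB - {v})"
    have E: "eA0 \<times> {v} \<union> ?C = eA0 \<times> eB"
      "eA \<times> {v} \<union> ?C = (\<Union>b\<in>eB. (if b = v then eA else eA0) \<times> {b})"
      using eB by (auto split: if_splits)
    show ?thesis
      unfolding PB_def
    proof (rule operator_sum_eq_of_common_complement[where C = ?C])
      show "finite (eA0 \<times> {v} \<union> ?C)" "finite (eA \<times> {v} \<union> ?C)"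
        using eA eB eA0 A.edge_finite B.edge_finite by auto
      show "sums_to_identity \<H> P (eA0 \<times> {v} \<union> ?C)"
        unfolding E using eB eA0 by (intro id prod_edge)
      show "sums_to_identity \<H> P (eA \<times> {v} \<union> ?C)"
        unfolding E using eA eB eA0 by (intro id foulis_randall_edgeI2) auto
    qed (use eA eB eA0 x P' A.edge_subset B.edge_subset in blast)+
  qed

  have projA: "projection \<H> (PA u)" if u: "u \<in> verts HA" for u
  proof -
    obtain eA where eA: "eA \<in> edges HA" "u \<in> eA"
      using u by (rule A.obtain_edge)
    show ?thesis
      unfolding PA_def
      by (rule projection_operator_sum[OF edge[OF eA(1) eB0]]) (use eA eB0 in auto)
  qed
  have projB: "projection \<H> (PB v)" if v: "v \<in> verts HB" for v
  proof -
    obtain eB where eB: "eB \<in> edges HB" "v \<in> eB"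
      using v by (rule B.obtain_edge)
    show ?thesis
      unfolding PB_def
      by (rule projection_operator_sum[OF edge[OF eA0 eB(1)]]) (use eB eA0 in auto)
  qed
  \<comment> \<open>The marginals are rewritten over edges \<open>eA\<close> and \<open>eB\<close>
    containing \<open>u\<close> and \<open>v\<close>. Inside \<open>eA \<times> eB\<close> the row
    of \<open>u\<close> and the column of \<open>v\<close> meet exactly in \<open>(u, v)\<close>.
    Both orders of the product thus agree, which also yields commutation.\<close>
  have both: "PA u (PB v x) = P (u, v) x \<and> PB v (PA u x) = P (u, v) x"
    if u: "u \<in> verts HA" and v: "v \<in> verts HB" and x: "x \<in> carrier \<H>" for u v x
  proof -
    obtain eA where eA: "eA \<in> edges HA" "u \<in> eA"
      using u by (rule A.obtain_edge)
    obtain eB where eB: "eB \<in> edges HB" "v \<in> eB"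
      using v by (rule B.obtain_edge)
    let ?D = "{u} \<times> eB" and ?D' = "eA \<times> {v}"
    have D: "?D \<subseteq> eA \<times> eB" "?D' \<subseteq> eA \<times> eB" "?D \<inter> ?D' = {(u, v)}" "?D' \<inter> ?D = {(u, v)}"
      using eA eB by auto
    note comp = operator_sum_compose[OF edge[OF eA(1) eB(1)]]
    have "PA u (PB v x) = operator_sum \<H> P {(u, v)} x"
      using PA_eq[OF u eB(1) projection_closed[OF projB[OF v] x]] PB_eq[OF v eA(1) x]
        comp[OF _ D(1,2) x] D(3) by simp
    moreover have "PB v (PA u x) = operator_sum \<H> P {(u, v)} x"
      using PB_eq[OF v eA(1) projection_closed[OF projA[OF u] x]] PA_eq[OF u eB(1) x]
        comp[OF _ D(2,1) x] D(4) by simp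
    ultimately show ?thesis
      using P'[OF u v] x by (simp add: operator_sum_singleton)
  qed
  have idA: "sums_to_identity \<H> PA eA" if eA: "eA \<in> edges HA" for eA
  proof (rule sums_to_identity_blocks[where D = "\<lambda>u. {u} \<times> eB0" and P = P])
    have E: "(\<Union>u\<in>eA. {u} \<times> eB0) = eA \<times> eB0"
      by auto
    show "sums_to_identity \<H> P (\<Union>u\<in>eA. {u} \<times> eB0)"
      unfolding E using eA eB0 by (intro id prod_edge)
    show "projection \<H> (P w)" if "w \<in> (\<Union>u\<in>eA. {u} \<times> eB0)" for w
      using that P_edge[OF eA eB0] unfolding E by blast
  qed (use eA eB0 A.edge_finite B.edge_finite in \<open>auto simp: PA_def disjoint_family_on_def\<close>)
  have idB: "sums_to_identity \<H> PB eB" if eB: "eB \<in> edges HB" for eB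
  proof (rule sums_to_identity_blocks[where D = "\<lambda>v. eA0 \<times> {v}" and P = P])
    have E: "(\<Union>v\<in>eB. eA0 \<times> {v}) = eA0 \<times> eB"
      by auto
    show "sums_to_identity \<H> P (\<Union>v\<in>eB. eA0 \<times> {v})"
      unfolding E using eB eA0 by (intro id prod_edge)
    show "projection \<H> (P w)" if "w \<in> (\<Union>v\<in>eB. eA0 \<times> {v})" for w
      using that P_edge[OF eA0 eB] unfolding E by blast
  qed (use eB eA0 A.edge_finite B.edge_finite in \<open>auto simp: PB_def disjoint_family_on_def\<close>)
  show thesis
    using both by (intro that[of PA PB] ballI) (auto simp: operators_commute_def projA projB idA idB)
qed

theorem proposition5p2p1:
  fixes HA :: "'a hypergraph" and HB :: "'b hypergraph" and p :: "'a \<times> 'b \<Rightarrow> real"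
  assumes "contextuality_scenario HA" and "contextuality_scenario HB"
    and "p \<in> prob_models (HA \<otimes>\<^sub>F\<^sub>R HB)"
  shows "quantum_model TYPE('h) (HA \<otimes>\<^sub>F\<^sub>R HB) p \<longleftrightarrow>
    (\<exists>(\<H> :: 'h hilbert) \<rho> PA PB.
       hilbert_space \<H> \<and> quantum_state \<H> \<rho> \<and>
       (\<forall>u\<in>verts HA. projection \<H> (PA u)) \<and>
       (\<forall>v\<in>verts HB. projection \<H> (PB v)) \<and>
       (\<forall>eA\<in>edges HA. sums_to_identity \<H> PA eA) \<and>
       (\<forall>eB\<in>edges HB. sums_to_identity \<H> PB eB) \<and>
       (\<forall>u\<in>verts HA. \<forall>v\<in>verts HB. operators_commute \<H> (PA u) (PB v)) \<and>
       (\<forall>u\<in>verts HA. \<forall>v\<in>verts HB.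
          complex_of_real (p (u, v)) = op_trace \<H> (\<rho> \<circ> PA u \<circ> PB v)))"
  (is "?Q \<longleftrightarrow> ?R")
proof
  assume ?Q
  then obtain \<H> :: "'h hilbert" and \<rho> P where H: "hilbert_space \<H>" and \<rho>: "quantum_state \<H> \<rho>"
    and P: "\<forall>w\<in>verts (HA \<otimes>\<^sub>F\<^sub>R HB). projection \<H> (P w)"
    and id: "\<forall>e\<in>edges (HA \<otimes>\<^sub>F\<^sub>R HB). sums_to_identity \<H> P e"
    and p: "\<forall>w\<in>verts (HA \<otimes>\<^sub>F\<^sub>R HB). complex_of_real (p w) = op_trace \<H> (\<rho> \<circ> P w)"
    unfolding quantum_model_def by blast
  obtain PA PB where local:
    "\<forall>u\<in>verts HA. projection \<H> (PA u)"
    "\<forall>v\<in>verts HB. projection \<H> (PB v)"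
    "\<forall>eA\<in>edges HA. sums_to_identity \<H> PA eA"
    "\<forall>eB\<in>edges HB. sums_to_identity \<H> PB eB"
    "\<forall>u\<in>verts HA. \<forall>v\<in>verts HB. operators_commute \<H> (PA u) (PB v)"
    and PAB: "\<forall>u\<in>verts HA. \<forall>v\<in>verts HB. \<forall>x\<in>carrier \<H>. PA u (PB v x) = P (u, v) x"
    by (rule joint_imp_local[OF assms(1,2) H bspec[OF P] bspec[OF id]])
  have "complex_of_real (p (u, v)) = op_trace \<H> (\<rho> \<circ> PA u \<circ> PB v)"
    if "u \<in> verts HA" "v \<in> verts HB" for u v
  proof -
    \<comment> \<open>The two operators are known to agree on the carrier only, hence the congruence
      rule for traces.\<close>
    have "op_trace \<H> (\<rho> \<circ> PA u \<circ> PB v) = op_trace \<H> (\<rho> \<circ> P (u, v))"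
      by (rule quantum_state_op_trace_cong[OF \<rho>]) (simp add: PAB that)
    then show ?thesis
      using p that by (simp add: verts_foulis_randall)
  qed
  then show ?R
    by (intro exI[of _ \<H>] exI[of _ \<rho>] exI[of _ PA] exI[of _ PB] conjI H \<rho> local) blast
next
  assume ?R
  then obtain \<H> :: "'h hilbert" and \<rho> PA PB where H: "hilbert_space \<H>" and \<rho>: "quantum_state \<H> \<rho>"
    and PA: "\<And>u. u \<in> verts HA \<Longrightarrow> projection \<H> (PA u)"
    and PB: "\<And>v. v \<in> verts HB \<Longrightarrow> projection \<H> (PB v)"
    and idA: "\<And>eA. eA \<in> edges HA \<Longrightarrow> sums_to_identity \<H> PA eA"
    and idB: "\<And>eB. eB \<in> edges HB \<Longrightarrow> sums_to_identity \<H> PB eB"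
    and comm: "\<And>u v. u \<in> verts HA \<Longrightarrow> v \<in> verts HB \<Longrightarrow> operators_commute \<H> (PA u) (PB v)"
    and p: "\<And>u v. u \<in> verts HA \<Longrightarrow> v \<in> verts HB \<Longrightarrow>
      complex_of_real (p (u, v)) = op_trace \<H> (\<rho> \<circ> PA u \<circ> PB v)"
    by blast
  let ?P = "\<lambda>(u, v) x. PA u (PB v x)"
  have "projection \<H> (?P w)" if "w \<in> verts (HA \<otimes>\<^sub>F\<^sub>R HB)" for w
    using that hilbert_space.projection_compose[OF H] PA PB comm
    by (auto simp: verts_foulis_randall)
  moreover have "sums_to_identity \<H> ?P e" if "e \<in> edges (HA \<otimes>\<^sub>F\<^sub>R HB)" for e
    using local_imp_joint[OF assms(1,2) H PA PB idA idB comm that] .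
  moreover have "complex_of_real (p w) = op_trace \<H> (\<rho> \<circ> ?P w)"
    if "w \<in> verts (HA \<otimes>\<^sub>F\<^sub>R HB)" for w
    using that p by (auto simp: verts_foulis_randall comp_def)
  \<comment> \<open>The range condition in \<open>quantum_model\<close> comes from \<open>p\<close>
    being a probabilistic model.\<close>
  moreover have "p \<in> verts (HA \<otimes>\<^sub>F\<^sub>R HB) \<rightarrow> {0..1}"
    using assms(3) by (simp add: prob_models_def)
  ultimately show ?Q
    unfolding quantum_model_def using H \<rho> by blast
qed

end
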